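(* Let $k\ge1$, $m=2^{k-1}$, $r\ge0$, $n=2^r$, let $I=(i_1,\dots,i_k)$ be nonnegative integers with $i_1+2i_2+\dots+k\,i_k=r$, and let $\mathcal H_I\subseteq Z_{2^k}^n$ be the linear code defined below. Then the co-$Z_{2^k}$-linear code $\tilde H_I=\Phi(\mathcal H_I)$ is a binary $(nm,\,2^{nm}/2nm,\,4)$-code, i.e. an extended $1$-perfect code.
   Context: Let $\bar b_1,\dots,\bar b_n$ be all elements of $\{1\}\times(2^{k-1}Z_{2^k})^{i_1}\times(2^{k-2}Z_{2^k})^{i_2}\times\dots\times(2^0Z_{2^k})^{i_k}$ in lexicographic order, $B_I$ the matrix with these columns, and $\mathcal H_I=\{\bar h\in Z_{2^k}^n:B_I\bar h^T=\bar0\}$. Let $\{H_0,\dots,H_{2m-1}\}$ be a partition of $Z_2^m$ into extended $1$-perfect binary $(m,2^m/2m,4)$-codes with $\bar0\in H_0$ and all words of $H_j$ having Hamming weight of the parity of $j$; $\Phi(x_1,\dots,x_n)=H_{x_1}\times\dots\times H_{x_n}$ and $\Phi(\mathcal C)=\bigcup_{\bar x\in\mathcal C}\Phi(\bar x)$. A binary $(N,M,d)$-code is a subset of $Z_2^N$ of size $M$ with pairwise Hamming distances at least $d$. *)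

theory Defs
  imports Complex_Main "HOL-Library.Z2" "HOL-Library.List_Lexorder" "HOL-Library.Disjoint_Sets"
begin

definition words :: "nat \<Rightarrow> bit list set" where
  "words N = {w. length w = N}"

definition hamming_weight :: "bit list \<Rightarrow> nat" where
  "hamming_weight w = card {i. i < length w \<and> w ! i \<noteq> 0}"

definition hamming_dist :: "bit list \<Rightarrow> bit list \<Rightarrow> nat" where
  "hamming_dist u v = card {i. i < length u \<and> u ! i \<noteq> v ! i}"

definition binary_code :: "nat \<Rightarrow> nat \<Rightarrow> nat \<Rightarrow> bit list set \<Rightarrow> bool" where
  "binary_code N M d C \<longleftrightarrow> C \<subseteq> words N \<and> card C = M \<and>
     (\<forall>u\<in>C. \<forall>v\<in>C. u \<noteq> v \<longrightarrow> d \<le> hamming_dist u v)"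

(* Divisibility is required so that the natural-number division is the exact quotient 2^N / 2N. *)
definition extended_1_perfect :: "nat \<Rightarrow> bit list set \<Rightarrow> bool" where
  "extended_1_perfect N C \<longleftrightarrow> 2 * N dvd 2 ^ N \<and> binary_code N (2 ^ N div (2 * N)) 4 C"

(* Elements of Z_{2^k} are represented by their residues 0, ..., 2^k - 1, which are also the
   order used for the lexicographic ordering and the indices of the codes H_j. *)
definition Zmod :: "nat \<Rightarrow> nat set" where
  "Zmod k = {..<2 ^ k}"

definition multiples :: "nat \<Rightarrow> nat \<Rightarrow> nat set" where
  "multiples k a = (\<lambda>x. (a * x) mod 2 ^ k) ` Zmod k"

(* The list of factors of
   {1} x (2^{k-1} Z_{2^k})^{I 1} x (2^{k-2} Z_{2^k})^{I 2} x ... x (2^0 Z_{2^k})^{I k};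
   only the values I 1, ..., I k of the function I matter. *)
definition column_factors :: "nat \<Rightarrow> (nat \<Rightarrow> nat) \<Rightarrow> nat set list" where
  "column_factors k I =
     {1} # concat (map (\<lambda>t. replicate (I t) (multiples k (2 ^ (k - t)))) [1..<Suc k])"

definition columns :: "nat \<Rightarrow> (nat \<Rightarrow> nat) \<Rightarrow> nat list list" where
  "columns k I = sorted_list_of_set (listset (column_factors k I))"

definition check_matrix :: "nat \<Rightarrow> (nat \<Rightarrow> nat) \<Rightarrow> nat \<Rightarrow> nat \<Rightarrow> nat" where
  "check_matrix k I s j = columns k I ! j ! s"

definition kernel_code :: "nat \<Rightarrow> (nat \<Rightarrow> nat) \<Rightarrow> nat list set" where
  "kernel_code k I =
     {h. length h = length (columns k I) \<and> set h \<subseteq> Zmod k \<and>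
         (\<forall>s < length (column_factors k I).
            (\<Sum>j < length (columns k I). check_matrix k I s j * h ! j) mod 2 ^ k = 0)}"

(* Words of H x_1 x ... x H x_n are identified with the concatenations of their blocks. *)
definition Phi :: "(nat \<Rightarrow> bit list set) \<Rightarrow> nat list \<Rightarrow> bit list set" where
  "Phi H x = concat ` listset (map H x)"

definition Phi_code :: "(nat \<Rightarrow> bit list set) \<Rightarrow> nat list set \<Rightarrow> bit list set" where
  "Phi_code H C = (\<Union>x\<in>C. Phi H x)"

lemma finite_card_listset:
  assumes "\<forall>A\<in>set As. finite A"
  shows "finite (listset As) \<and> card (listset As) = prod_list (map card As)"
  using assms
proof (induction As)
  case (Cons A As)
  have eq: "listset (A # As) = (\<lambda>(x, xs). x # xs) ` (A \<times> listset As)"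
    by (auto simp: set_Cons_def)
  have "inj_on (\<lambda>(x, xs). x # xs) (A \<times> listset As)"
    by (auto simp: inj_on_def)
  then show ?case
    using Cons unfolding eq by (simp add: card_image card_cartesian_product)
qed simp

lemma card_multiples:
  assumes "t \<le> k"
  shows "card (multiples k (2 ^ (k - t))) = 2 ^ t"
proof -
  have pow: "(2::nat) ^ k = 2 ^ (k - t) * 2 ^ t"
    using assms by (simp flip: power_add)
  have "multiples k (2 ^ (k - t)) = (\<lambda>x. 2 ^ (k - t) * x) ` {..<2 ^ t}"
  proof (intro equalityI subsetI)
    fix y assume "y \<in> multiples k (2 ^ (k - t))"
    then obtain x where "y = (2 ^ (k - t) * x) mod 2 ^ k"
      by (auto simp: multiples_def)
    then have "y = 2 ^ (k - t) * (x mod 2 ^ t)"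
      by (simp add: pow flip: mult_mod_right)
    then show "y \<in> (\<lambda>x. 2 ^ (k - t) * x) ` {..<2 ^ t}"
      by auto
  next
    fix y assume "y \<in> (\<lambda>x::nat. 2 ^ (k - t) * x) ` {..<2 ^ t}"
    then obtain x where x: "y = 2 ^ (k - t) * x" "x < 2 ^ t"
      by auto
    have "(2::nat) ^ t \<le> 2 ^ k"
      using assms by (rule power_increasing) simp
    then have "x \<in> Zmod k"
      using x(2) unfolding Zmod_def by (metis lessThan_iff less_le_trans)
    moreover have "y = (2 ^ (k - t) * x) mod 2 ^ k"
      using x by (simp add: pow flip: mult_mod_right)
    ultimately show "y \<in> multiples k (2 ^ (k - t))"
      by (auto simp: multiples_def)
  qed
  then show ?thesis
    by (simp add: card_image inj_on_def)
qed

lemma length_columns: "length (columns k I) = 2 ^ (\<Sum>t = 1..k. t * I t)"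
proof -
  have fin: "\<forall>A\<in>set (column_factors k I). finite A"
    by (auto simp: column_factors_def multiples_def Zmod_def)
  have "prod_list (map card (concat (map (\<lambda>t. replicate (I t) (multiples k (2 ^ (k - t)))) ts)))
      = 2 ^ (\<Sum>t\<leftarrow>ts. t * I t)" if "set ts \<subseteq> {1..k}" for ts
    using that
    by (induction ts) (auto simp: map_concat card_multiples power_add power_mult prod_list_replicate)
  moreover have "set [1..<Suc k] \<subseteq> {1..k}"
    by auto
  moreover have "card (listset (column_factors k I)) = prod_list (map card (column_factors k I))"
    using finite_card_listset[OF fin] by blast
  ultimately have "card (listset (column_factors k I)) = 2 ^ (\<Sum>t\<leftarrow>[1..<Suc k]. t * I t)"
    unfolding column_factors_def by (simp del: upt_Suc One_nat_def listset.simps)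
  also have "(\<Sum>t\<leftarrow>[1..<Suc k]. t * I t) = (\<Sum>t = 1..k. t * I t)"
    by (simp add: sum_list_distinct_conv_sum_set atLeastLessThanSuc_atLeastAtMost del: upt_Suc)
  finally show ?thesis
    by (simp add: columns_def)
qed

end

(* Size: the syndrome map h |-> B_I h is additive and onto the subgroup
   Z_{2^k} x (2^{k-1} Z_{2^k})^{i_1} x ... x (Z_{2^k})^{i_k}, which has 2^k n elements (a vector
   (c, a) is the sum of the column (1, a) and c - 1 times the column (1, 0)), so its fibres are
   equally large. Distance: the first check row makes all words of the code even, so it suffices
   to exclude distance 2. Words over the same codeword differ inside one block, hence in at least
   4 places. Two different codewords differ in at least 3 blocks, or in exactly 2 blocks where
   the entries have equal parity, and then each of the blocks contributes at least 2. *)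

theory Submission
  imports Defs
begin

section \<open>Hamming distance and blocks\<close>

text \<open>Splits off position 0, which turns the index-set definitions of distance and weight into
  recursions along \<open>#\<close>.\<close>

lemma card_less_Suc_split:
  "card {i. i < Suc n \<and> P i} = (if P 0 then 1 else 0) + card {i. i < n \<and> P (Suc i)}"
proof -
  have "{i. i < Suc n \<and> P i} = (if P 0 then {0} else {}) \<union> Suc ` {i. i < n \<and> P (Suc i)}"
    by (auto simp: less_Suc_eq_0_disj)
  then show ?thesis
    by (auto simp: card_image)
qed

lemma hamming_dist_Nil [simp]: "hamming_dist [] v = 0"
  by (simp add: hamming_dist_def)

lemma hamming_dist_Cons [simp]:
  "hamming_dist (a # u) (b # v) = (if a \<noteq> b then 1 else 0) + hamming_dist u v"
  by (simp add: hamming_dist_def card_less_Suc_split)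

lemma hamming_weight_Nil [simp]: "hamming_weight [] = 0"
  by (simp add: hamming_weight_def)

lemma hamming_weight_Cons [simp]:
  "hamming_weight (a # u) = (if a \<noteq> 0 then 1 else 0) + hamming_weight u"
  by (simp add: hamming_weight_def card_less_Suc_split)

lemma hamming_dist_append:
  assumes "length u = length u'"
  shows "hamming_dist (u @ v) (u' @ v') = hamming_dist u u' + hamming_dist v v'"
  using assms by (induction u u' rule: list_induct2) auto

lemma hamming_dist_pos:
  assumes "length u = length v" "u \<noteq> v"
  shows "hamming_dist u v > 0"
  using assms by (induction u v rule: list_induct2) auto

text \<open>Unequal bits add 1 to the sum of the weights, equal bits add 0 or 2. This lets the
  prescribed weight parity of the codes \<open>H j\<close> control distances between blocks.\<close>

lemma even_hamming_dist_iff: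
  assumes "length u = length v"
  shows "even (hamming_dist u v) \<longleftrightarrow> even (hamming_weight u + hamming_weight v)"
  using assms
proof (induction u v rule: list_induct2)
  case (Cons a u b v)
  then show ?case by (cases a; cases b) auto
qed simp

text \<open>Matching block lengths keep the two concatenations aligned, so positions are compared
  block by block.\<close>

lemma hamming_dist_concat:
  assumes "length us = length vs" "\<And>i. i < length us \<Longrightarrow> length (us ! i) = length (vs ! i)"
  shows "hamming_dist (concat us) (concat vs) = (\<Sum>i<length us. hamming_dist (us ! i) (vs ! i))"
  using assms
proof (induction us vs rule: list_induct2)
  case (Cons u us v vs)
  have "length u = length v"
    using Cons.prems[of 0] by simp
  moreover have "hamming_dist (concat us) (concat vs)
      = (\<Sum>i<length us. hamming_dist (us ! i) (vs ! i))"
    using Cons.prems[of "Suc _"] by (intro Cons.IH) simp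
  ultimately show ?case
    by (simp add: hamming_dist_append sum.lessThan_Suc_shift del: sum.lessThan_Suc)
qed simp

text \<open>Replaces the recursive description of \<open>listset\<close> by a positional one, which
  serves for columns and for words of blocks alike.\<close>

lemma in_listset_iff:
  "w \<in> listset As \<longleftrightarrow> length w = length As \<and> (\<forall>i<length As. w ! i \<in> As ! i)"
proof (induction As arbitrary: w)
  case (Cons A As)
  show ?case
  proof (cases w)
    case (Cons a v)
    have "w \<in> listset (A # As) \<longleftrightarrow> a \<in> A \<and> v \<in> listset As"
      by (simp add: set_Cons_def Cons)
    then show ?thesis
      unfolding Cons.IH by (auto simp: Cons All_less_Suc2)
  qed (simp add: set_Cons_def)
qed simp

lemma length_concat_blocks:
  assumes "\<And>u. u \<in> set us \<Longrightarrow> length u = m"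
  shows "length (concat us) = length us * m"
  using assms by (induction us) auto

section \<open>Counting the kernel\<close>

lemma mod_sum_mult_mod:
  fixes b e :: "nat \<Rightarrow> nat"
  shows "(\<Sum>j<n. b j * (e j mod q)) mod q = (\<Sum>j<n. b j * e j) mod q"
proof -
  have "(\<Sum>j<n. b j * (e j mod q)) mod q = (\<Sum>j<n. b j * (e j mod q) mod q) mod q"
    by (simp only: mod_sum_eq)
  also have "\<dots> = (\<Sum>j<n. b j * e j) mod q"
    by (simp only: mod_mult_right_eq mod_sum_eq)
  finally show ?thesis .
qed

text \<open>Here \<open>q - b\<close> stands for the negative of \<open>b\<close> modulo
  \<open>q\<close>; for \<open>b = 0\<close> it equals \<open>q\<close>, which is harmless under the
  outer reduction.\<close>

lemma mod_add_diff_cancel: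
  fixes a b q :: nat
  assumes "a < q" "b < q"
  shows "((a + b) mod q + (q - b)) mod q = a"
proof -
  have "((a + b) mod q + (q - b)) mod q = (a + b + (q - b)) mod q"
    by (rule mod_add_left_eq)
  also have "a + b + (q - b) = a + q"
    using assms by linarith
  finally show ?thesis
    using assms by simp
qed

text \<open>The sum is below \<open>2 * q\<close>; if it reached \<open>q\<close>, its residue would
  be \<open>a + b - q\<close>, and \<open>a\<close> would have to be \<open>q\<close>.\<close>

lemma mod_add_right_self_imp_0:
  fixes a b q :: nat
  assumes "(a + b) mod q = b" "a < q"
  shows "a = 0"
proof (cases "a + b < q")
  case False
  have "b < q"
    using assms by (metis gr_implies_not0 mod_less_divisor gr0I)
  then have "(a + b) mod q = a + b - q"
    using False assms(2) by (simp add: le_mod_geq)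
  then show ?thesis
    using assms False by linarith
qed (use assms in simp)

section \<open>Factors and columns of the check matrix\<close>

text \<open>As \<open>a\<close> divides the modulus, reduction preserves divisibility by
  \<open>a\<close>, and a multiple that is already reduced has its cofactor in
  \<open>Zmod k\<close>.\<close>

lemma multiples_eq:
  assumes "a dvd 2 ^ k"
  shows "multiples k a = {y. y < 2 ^ k \<and> a dvd y}"
proof (intro equalityI subsetI)
  fix y assume "y \<in> multiples k a"
  then show "y \<in> {y. y < 2 ^ k \<and> a dvd y}"
    using assms by (auto simp: multiples_def dvd_mod)
next
  fix y assume y: "y \<in> {y. y < 2 ^ k \<and> a dvd y}"
  then obtain x where x: "y = a * x" by auto
  have "a > 0" using assms by (auto intro: Nat.gr0I)
  then have "x \<le> y" using x by simp
  then have "x \<in> Zmod k" using y by (simp add: Zmod_def)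
  then show "y \<in> multiples k a"
    using x y by (auto simp: multiples_def intro!: image_eqI[where x = x])
qed

text \<open>Flattens the grouping by exponents into one divisor of \<open>2 ^ k\<close> per row
  after the first, so that later arguments treat all these rows uniformly.\<close>

lemma column_factors_eq:
  obtains as where "\<And>a. a \<in> set as \<Longrightarrow> a dvd 2 ^ k"
    and "column_factors k I = {1} # map (\<lambda>a. {y. y < 2 ^ k \<and> a dvd y}) as"
proof
  let ?as = "concat (map (\<lambda>t. replicate (I t) (2 ^ (k - t))) [1..<Suc k]) :: nat list"
  show "a dvd 2 ^ k" if "a \<in> set ?as" for a
    using that by (auto simp: le_imp_power_dvd simp del: upt_Suc)
  show "column_factors k I = {1} # map (\<lambda>a. {y. y < 2 ^ k \<and> a dvd y}) ?as"
    by (simp add: column_factors_def map_concat comp_def multiples_eq le_imp_power_dvd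
        del: upt_Suc)
qed

lemma set_columns: "set (columns k I) = listset (column_factors k I)"
proof -
  have "\<forall>A\<in>set (column_factors k I). finite A"
    by (auto simp: column_factors_def multiples_def Zmod_def)
  then have "finite (listset (column_factors k I))"
    using finite_card_listset by blast
  then show ?thesis
    by (simp add: columns_def)
qed

lemma distinct_columns: "distinct (columns k I)"
  by (simp add: columns_def)

lemma length_column:
  assumes "j < length (columns k I)"
  shows "length (columns k I ! j) = length (column_factors k I)"
  using nth_mem[OF assms] by (simp add: set_columns in_listset_iff)

lemma column_nth_in:
  assumes "j < length (columns k I)" "s < length (column_factors k I)"
  shows "columns k I ! j ! s \<in> column_factors k I ! s"
  using nth_mem[OF assms(1)] assms(2) by (simp add: set_columns in_listset_iff)

lemma column_nth_0:
  assumes "j < length (columns k I)"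
  shows "columns k I ! j ! 0 = 1"
  using column_nth_in[OF assms, of 0] by (simp add: column_factors_def)

section \<open>The syndrome map, its fibres and its image\<close>

definition syndrome :: "nat \<Rightarrow> (nat \<Rightarrow> nat) \<Rightarrow> nat list \<Rightarrow> nat list" where
  "syndrome k I h =
     map (\<lambda>s. (\<Sum>j<length (columns k I). columns k I ! j ! s * h ! j) mod 2 ^ k)
       [0..<length (column_factors k I)]"

text \<open>The conjuncts follow the form of \<open>finite_lists_length_eq\<close> and
  \<open>card_lists_length_eq\<close>.\<close>

definition ambient :: "nat \<Rightarrow> (nat \<Rightarrow> nat) \<Rightarrow> nat list set" where
  "ambient k I = {h. set h \<subseteq> Zmod k \<and> length h = length (columns k I)}"

lemma kernel_code_eq:
  "kernel_code k I =
     {h \<in> ambient k I. syndrome k I h = replicate (length (column_factors k I)) 0}"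
proof -
  have "syndrome k I h = replicate (length (column_factors k I)) 0 \<longleftrightarrow>
      (\<forall>s<length (column_factors k I).
        (\<Sum>j<length (columns k I). check_matrix k I s j * h ! j) mod 2 ^ k = 0)" for h
    by (simp only: list_eq_iff_nth_eq) (simp add: syndrome_def check_matrix_def)
  then show ?thesis
    unfolding kernel_code_def ambient_def by blast
qed

lemma ambient_nth_less:
  assumes "h \<in> ambient k I" "j < length (columns k I)"
  shows "h ! j < 2 ^ k"
proof -
  have "set h \<subseteq> Zmod k" "j < length h"
    using assms by (simp_all add: ambient_def)
  then have "h ! j \<in> Zmod k"
    using nth_mem by blast
  then show ?thesis
    by (simp add: Zmod_def)
qed

lemma finite_ambient: "finite (ambient k I)"
  unfolding ambient_def by (rule finite_lists_length_eq) (simp add: Zmod_def)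

lemma card_ambient: "card (ambient k I) = 2 ^ (k * length (columns k I))"
  unfolding ambient_def by (subst card_lists_length_eq) (simp_all add: Zmod_def power_mult)

text \<open>Turns unreduced coefficients into a word over \<open>Zmod k\<close>; its syndrome can
  then be computed without reducing the entries.\<close>

definition residue_vector :: "nat \<Rightarrow> (nat \<Rightarrow> nat) \<Rightarrow> (nat \<Rightarrow> nat) \<Rightarrow> nat list" where
  "residue_vector k I e = map (\<lambda>j. e j mod 2 ^ k) [0..<length (columns k I)]"

lemma residue_vector_in_ambient: "residue_vector k I e \<in> ambient k I"
  by (auto simp: residue_vector_def ambient_def Zmod_def)

lemma residue_vector_nth:
  "j < length (columns k I) \<Longrightarrow> residue_vector k I e ! j = e j mod 2 ^ k"
  by (simp add: residue_vector_def)

lemma length_syndrome: "length (syndrome k I h) = length (column_factors k I)"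
  by (simp add: syndrome_def)

lemma syndrome_nth:
  "s < length (column_factors k I) \<Longrightarrow>
   syndrome k I h ! s = (\<Sum>j<length (columns k I). columns k I ! j ! s * h ! j) mod 2 ^ k"
  by (simp add: syndrome_def)

lemma syndrome_residue_vector_nth:
  assumes "s < length (column_factors k I)"
  shows "syndrome k I (residue_vector k I e) ! s =
    (\<Sum>j<length (columns k I). columns k I ! j ! s * e j) mod 2 ^ k"
  using assms by (simp add: syndrome_nth residue_vector_nth mod_sum_mult_mod)

text \<open>Translation by \<open>g\<close> carries the kernel onto the fibre through
  \<open>g\<close>. The inverse is translation by the negative of \<open>g\<close>, with entries
  \<open>2 ^ k - g ! j\<close>.\<close>

lemma card_syndrome_fibre:
  assumes g: "g \<in> ambient k I"
  shows "card {h \<in> ambient k I. syndrome k I h = syndrome k I g} = card (kernel_code k I)"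
proof -
  let ?q = "2 ^ k :: nat"
  define f where "f h = residue_vector k I (\<lambda>j. h ! j + g ! j)" for h
  define f' where "f' h = residue_vector k I (\<lambda>j. h ! j + (?q - g ! j))" for h
  have syn_f: "syndrome k I (f h) ! s = (syndrome k I h ! s + syndrome k I g ! s) mod ?q"
    if "s < length (column_factors k I)" for h s
    unfolding f_def syndrome_residue_vector_nth[OF that]
    by (simp add: syndrome_nth that distrib_left sum.distrib mod_add_eq)
  have ff': "f (f' h) = h" if "h \<in> ambient k I" for h
  proof (rule nth_equalityI)
    show "length (f (f' h)) = length h"
      using that by (simp add: f_def residue_vector_def ambient_def)
    fix j assume "j < length (f (f' h))"
    then have j: "j < length (columns k I)"
      by (simp add: f_def residue_vector_def)
    show "f (f' h) ! j = h ! j"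
      using ambient_nth_less[OF that j] ambient_nth_less[OF g j]
      by (simp add: f_def f'_def residue_vector_nth j mod_add_left_eq)
  qed
  have f'f: "f' (f h) = h" if "h \<in> ambient k I" for h
  proof (rule nth_equalityI)
    show "length (f' (f h)) = length h"
      using that by (simp add: f'_def residue_vector_def ambient_def)
    fix j assume "j < length (f' (f h))"
    then have j: "j < length (columns k I)"
      by (simp add: f'_def residue_vector_def)
    show "f' (f h) ! j = h ! j"
      unfolding f_def f'_def residue_vector_nth[OF j]
      using ambient_nth_less[OF that j] ambient_nth_less[OF g j] by (rule mod_add_diff_cancel)
  qed
  have "bij_betw f (kernel_code k I) {h \<in> ambient k I. syndrome k I h = syndrome k I g}"
  proof (rule bij_betw_byWitness[where f' = f'])
    show "\<forall>a\<in>kernel_code k I. f' (f a) = a"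
      by (simp add: kernel_code_eq f'f)
    show "\<forall>a'\<in>{h \<in> ambient k I. syndrome k I h = syndrome k I g}. f (f' a') = a'"
      by (simp add: ff')
    show "f ` kernel_code k I \<subseteq> {h \<in> ambient k I. syndrome k I h = syndrome k I g}"
    proof clarify
      fix h assume h: "h \<in> kernel_code k I"
      have "syndrome k I (f h) = syndrome k I g"
      proof (rule nth_equalityI)
        fix s assume "s < length (syndrome k I (f h))"
        then have s: "s < length (column_factors k I)"
          by (simp add: length_syndrome)
        then show "syndrome k I (f h) ! s = syndrome k I g ! s"
          using h by (simp add: syn_f kernel_code_eq) (simp add: syndrome_nth)
      qed (simp add: length_syndrome)
      then show "f h \<in> ambient k I \<and> syndrome k I (f h) = syndrome k I g"
        by (simp add: f_def residue_vector_in_ambient)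
    qed
    show "f' ` {h \<in> ambient k I. syndrome k I h = syndrome k I g} \<subseteq> kernel_code k I"
    proof clarify
      fix h assume h: "h \<in> ambient k I" "syndrome k I h = syndrome k I g"
      have "syndrome k I (f' h) ! s = 0" if s: "s < length (column_factors k I)" for s
      proof -
        \<comment> \<open>Additivity is available for \<open>f\<close> only; applied to
          \<open>f (f' h) = h\<close> it determines the syndrome of \<open>f' h\<close>
          indirectly.\<close>
        have "(syndrome k I (f' h) ! s + syndrome k I g ! s) mod ?q = syndrome k I g ! s"
          using syn_f[OF s, of "f' h"] h by (simp add: ff')
        moreover have "syndrome k I (f' h) ! s < ?q"
          using s by (simp add: syndrome_nth)
        ultimately show ?thesis
          by (rule mod_add_right_self_imp_0)
      qed
      then have "syndrome k I (f' h) = replicate (length (column_factors k I)) 0"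
        by (intro nth_equalityI) (simp_all add: length_syndrome)
      then show "f' h \<in> kernel_code k I"
        by (simp add: kernel_code_eq f'_def residue_vector_in_ambient)
    qed
  qed
  then show ?thesis
    by (simp add: bij_betw_same_card)
qed

text \<open>Only the first factor changes: combinations of 1 fill the whole ring, while every other
  factor is an ideal and so is closed under linear combinations.\<close>

lemma syndrome_image:
  "syndrome k I ` ambient k I = listset (Zmod k # tl (column_factors k I))"
proof -
  let ?q = "2 ^ k :: nat" and ?n = "length (columns k I)"
  obtain as where as: "\<And>a. a \<in> set as \<Longrightarrow> a dvd ?q"
    and cf: "column_factors k I = {1} # map (\<lambda>a. {y. y < ?q \<and> a dvd y}) as"
    using column_factors_eq by blast
  show ?thesis
  proof (intro equalityI subsetI)
    fix w assume "w \<in> syndrome k I ` ambient k I"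
    then obtain h where w: "w = syndrome k I h" by blast
    have "w ! s \<in> (Zmod k # tl (column_factors k I)) ! s" if s: "s < Suc (length as)" for s
    proof (cases s)
      case 0
      then show ?thesis
        using s by (simp add: w syndrome_nth Zmod_def cf)
    next
      case (Suc s')
      \<comment> \<open>All entries of row \<open>s\<close> lie in the ideal of
        \<open>as ! s'\<close>, hence so does their combination; reduction respects this since
        \<open>as ! s'\<close> divides \<open>2 ^ k\<close>.\<close>
      have "as ! s' dvd columns k I ! j ! s" if "j < ?n" for j
        using column_nth_in[OF that, of s] s Suc by (simp add: cf)
      then have "as ! s' dvd (\<Sum>j<?n. columns k I ! j ! s * h ! j)"
        by (intro dvd_sum) auto
      then have "as ! s' dvd w ! s"
        using s Suc as by (simp add: w syndrome_nth cf dvd_mod)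
      then show ?thesis
        using s Suc by (simp add: w syndrome_nth cf)
    qed
    then show "w \<in> listset (Zmod k # tl (column_factors k I))"
      unfolding in_listset_iff by (simp add: w length_syndrome cf)
  next
    fix w assume w: "w \<in> listset (Zmod k # tl (column_factors k I))"
    have lw: "length w = Suc (length as)"
      using w unfolding in_listset_iff by (simp add: cf)
    have w0: "w ! 0 < ?q"
      using w unfolding in_listset_iff by (auto simp: Zmod_def)
    have wS: "w ! Suc s < ?q \<and> as ! s dvd w ! Suc s" if "s < length as" for s
      using w that unfolding in_listset_iff by (auto simp: cf)
    have "1 # tl w \<in> set (columns k I)"
      unfolding set_columns in_listset_iff
      using lw wS by (auto simp: cf less_Suc_eq_0_disj nth_tl)
    then obtain j1 where j1: "j1 < ?n" "columns k I ! j1 = 1 # tl w"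
      by (auto simp: in_set_conv_nth)
    have "1 # replicate (length as) 0 \<in> set (columns k I)"
      unfolding set_columns in_listset_iff by (auto simp: cf less_Suc_eq_0_disj)
    then obtain j0 where j0: "j0 < ?n" "columns k I ! j0 = 1 # replicate (length as) 0"
      by (auto simp: in_set_conv_nth)
    \<comment> \<open>The coefficient \<open>w ! 0 - 1\<close> is raised by \<open>2 ^ k\<close> to
      avoid truncated subtraction at \<open>w ! 0 = 0\<close>. Two separate summands are used
      because \<open>j0 = j1\<close> when \<open>tl w\<close> is zero.\<close>
    define e where
      "e j = (if j = j0 then w ! 0 + ?q - 1 else 0) + (if j = j1 then 1 else 0)" for j
    have "syndrome k I (residue_vector k I e) = w"
    proof (rule nth_equalityI)
      show "length (syndrome k I (residue_vector k I e)) = length w"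
        by (simp add: length_syndrome lw cf)
      fix s assume "s < length (syndrome k I (residue_vector k I e))"
      then have s: "s < length (column_factors k I)"
        by (simp add: length_syndrome)
      have "(\<Sum>j<?n. columns k I ! j ! s * e j)
          = (\<Sum>j<?n. if j = j0 then columns k I ! j ! s * (w ! 0 + ?q - 1) else 0)
            + (\<Sum>j<?n. if j = j1 then columns k I ! j ! s else 0)"
        unfolding sum.distrib[symmetric] by (intro sum.cong) (auto simp: e_def algebra_simps)
      also have "\<dots> = columns k I ! j0 ! s * (w ! 0 + ?q - 1) + columns k I ! j1 ! s"
        using j0(1) j1(1) by (simp add: sum.delta)
      finally have sum_eq: "(\<Sum>j<?n. columns k I ! j ! s * e j)
          = (1 # replicate (length as) 0) ! s * (w ! 0 + ?q - 1) + (1 # tl w) ! s"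
        by (simp add: j0 j1)
      show "syndrome k I (residue_vector k I e) ! s = w ! s"
      proof (cases s)
        case 0
        then show ?thesis
          using w0 unfolding syndrome_residue_vector_nth[OF s] sum_eq by simp
      next
        case (Suc s')
        then show ?thesis
          using wS[of s'] s lw unfolding syndrome_residue_vector_nth[OF s] sum_eq
          by (simp add: cf nth_tl)
      qed
    qed
    then show "w \<in> syndrome k I ` ambient k I"
      using residue_vector_in_ambient by (metis image_eqI)
  qed
qed

text \<open>Counts the ambient space by syndrome fibres of equal size. The product form avoids
  natural-number division.\<close>

lemma card_kernel_code:
  "card (kernel_code k I) * (2 ^ k * length (columns k I)) = 2 ^ (k * length (columns k I))"
proof -
  let ?T = "syndrome k I ` ambient k I"
  obtain As where cf: "column_factors k I = {1} # As"
    by (simp add: column_factors_def)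
  have "\<forall>A\<in>set (column_factors k I). finite A"
    by (auto simp: column_factors_def multiples_def Zmod_def)
  then have fin: "\<forall>A\<in>set As. finite A"
    by (simp add: cf)
  then have fin1: "\<forall>A\<in>set ({1} # As). finite A" and finZ: "\<forall>A\<in>set (Zmod k # As). finite A"
    by (simp_all add: Zmod_def)
  \<comment> \<open>Exchanging the singleton factor for \<open>Zmod k\<close> multiplies the size by
    \<open>2 ^ k\<close>, so the number of syndromes is \<open>2 ^ k\<close> times the number of
    columns.\<close>
  have "length (columns k I) = card (listset ({1} # As))"
    by (simp add: columns_def cf)
  then have "card ?T = 2 ^ k * length (columns k I)"
    using finite_card_listset[OF fin1] finite_card_listset[OF finZ]
    by (simp add: syndrome_image cf Zmod_def del: listset.simps)
  moreover have "card (ambient k I)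
      = (\<Sum>y\<in>?T. card {h \<in> ambient k I. syndrome k I h = y})"
    using sum.image_gen[OF finite_ambient, of "\<lambda>_. 1::nat" k I "syndrome k I"] by simp
  moreover have "\<dots> = (\<Sum>y\<in>?T. card (kernel_code k I))"
    by (intro sum.cong) (auto simp: card_syndrome_fibre)
  ultimately show ?thesis
    by (simp add: card_ambient mult.commute)
qed

section \<open>Minimum distance\<close>

text \<open>Congruent reduced residues coincide. The difference is taken over the integers, as it
  may be negative.\<close>

lemma dvd_diff_less_imp_eq:
  fixes x y q :: nat
  assumes "int q dvd int x - int y" "x < q" "y < q"
  shows "x = y"
  using assms by (metis mod_eq_dvd_iff mod_less of_nat_mod nat_int zmod_int)

text \<open>Subtracting the check equations of two codewords leaves only the positions where they
  differ.\<close>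

lemma kernel_code_sum_dvd:
  assumes "x \<in> kernel_code k I" "y \<in> kernel_code k I" "s < length (column_factors k I)"
  shows "2 ^ k dvd (\<Sum>j | j < length (columns k I) \<and> x ! j \<noteq> y ! j.
           int (columns k I ! j ! s) * (int (x ! j) - int (y ! j)))"
proof -
  let ?n = "length (columns k I)"
  have "int (2 ^ k) dvd int (\<Sum>j<?n. columns k I ! j ! s * h ! j)" if "h \<in> kernel_code k I" for h
    using that assms(3) unfolding int_dvd_int_iff by (auto simp: kernel_code_def check_matrix_def)
  from dvd_diff[OF this[OF assms(1)] this[OF assms(2)]]
  have "2 ^ k dvd (\<Sum>j<?n. int (columns k I ! j ! s) * (int (x ! j) - int (y ! j)))"
    by (simp add: right_diff_distrib sum_subtractf)
  also have "(\<Sum>j<?n. int (columns k I ! j ! s) * (int (x ! j) - int (y ! j)))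
     = (\<Sum>j | j < ?n \<and> x ! j \<noteq> y ! j. int (columns k I ! j ! s) * (int (x ! j) - int (y ! j)))"
    by (rule sum.mono_neutral_right) auto
  finally show ?thesis .
qed

lemma kernel_code_nth_less:
  assumes "x \<in> kernel_code k I" "j < length (columns k I)"
  shows "x ! j < 2 ^ k"
  using assms by (auto simp: kernel_code_eq ambient_nth_less)

text \<open>The first check row consists of ones, and its modulus \<open>2 ^ k\<close> is
  even.\<close>

lemma kernel_code_even_sum:
  assumes "k \<ge> 1" "x \<in> kernel_code k I"
  shows "even (\<Sum>j<length (columns k I). x ! j)"
proof -
  have "2 ^ k dvd (\<Sum>j<length (columns k I). columns k I ! j ! 0 * x ! j)"
    using assms(2) by (auto simp: kernel_code_def check_matrix_def column_factors_def)
  then have "2 ^ k dvd (\<Sum>j<length (columns k I). x ! j)"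
    by (simp add: column_nth_0)
  moreover have "(2::nat) dvd 2 ^ k"
    using assms(1) by simp
  ultimately show ?thesis
    using dvd_trans by blast
qed

text \<open>If two codewords differ only at positions \<open>i \<noteq> j\<close>, the first check row gives
  \<open>d\<^sub>i = - d\<^sub>j\<close> for the differences, so \<open>d\<^sub>i (b\<^sub>i - b\<^sub>j) = 0\<close>; since \<open>b\<^sub>i \<noteq> b\<^sub>j\<close>,
  \<open>d\<^sub>i\<close> is a zero divisor modulo \<open>2^k\<close>, hence even.\<close>

lemma kernel_code_difference:
  assumes k: "k \<ge> 1" and x: "x \<in> kernel_code k I" and y: "y \<in> kernel_code k I" and "x \<noteq> y"
  defines "D \<equiv> {j. j < length (columns k I) \<and> x ! j \<noteq> y ! j}"
  shows "card D \<ge> 3 \<or> card D = 2 \<and> (\<forall>j\<in>D. even (x ! j + y ! j))"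
proof -
  let ?b = "\<lambda>j s. int (columns k I ! j ! s)" and ?d = "\<lambda>j. int (x ! j) - int (y ! j)"
  have fin: "finite D"
    by (simp add: D_def)
  have dvd: "2 ^ k dvd (\<Sum>j\<in>D. ?b j s * ?d j)" if "s < length (column_factors k I)" for s
    using kernel_code_sum_dvd[OF x y that] by (simp add: D_def)
  have b0: "?b j 0 = 1" if "j \<in> D" for j
    using that column_nth_0 by (simp add: D_def)
  have "2 ^ k dvd (\<Sum>j\<in>D. ?b j 0 * ?d j)"
    by (rule dvd) (simp add: column_factors_def)
  then have dvd0: "2 ^ k dvd (\<Sum>j\<in>D. ?d j)"
    by (simp add: b0)
  have "length x = length y"
    using x y by (simp add: kernel_code_def)
  then have "D \<noteq> {}"
    using \<open>x \<noteq> y\<close> x by (auto simp: D_def kernel_code_def list_eq_iff_nth_eq)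
  then have "card D \<noteq> 0"
    using fin by simp
  moreover have "card D \<noteq> 1"
  proof
    assume "card D = 1"
    then obtain i where D: "D = {i}"
      by (auto simp: card_1_singleton_iff)
    then have i: "i < length (columns k I)" "x ! i \<noteq> y ! i"
      unfolding D_def by blast+
    \<comment> \<open>With one differing position, the first check row would make the two reduced
      entries congruent there.\<close>
    from dvd0 have "int (2 ^ k) dvd int (x ! i) - int (y ! i)"
      by (simp add: D)
    then show False
      using i x y kernel_code_nth_less dvd_diff_less_imp_eq by blast
  qed
  moreover have "\<forall>j\<in>D. even (x ! j + y ! j)" if card_D: "card D = 2"
  proof -
    obtain i j where D: "D = {i, j}" and ij: "i \<noteq> j"
      using card_D unfolding card_2_iff by blast
    then have lt: "i < length (columns k I)" "j < length (columns k I)"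
      unfolding D_def by blast+
    from dvd0 have dij: "2 ^ k dvd ?d i + ?d j"
      using ij by (simp add: D)
    have "even (?d i)"
    proof (rule ccontr)
      assume odd: "odd (?d i)"
      have "columns k I ! i ! s = columns k I ! j ! s" if s: "s < length (column_factors k I)" for s
      proof (rule dvd_diff_less_imp_eq)
        have "2 ^ k dvd ?b i s * ?d i + ?b j s * ?d j"
          using dvd[OF s] ij by (simp add: D)
        \<comment> \<open>Subtracting the first row, scaled by the entry of column \<open>j\<close>,
          eliminates the difference at \<open>j\<close>.\<close>
        then have "2 ^ k dvd (?b i s * ?d i + ?b j s * ?d j) - ?b j s * (?d i + ?d j)"
          using dij by (intro dvd_diff dvd_mult)
        then have "2 ^ k dvd ?d i * (?b i s - ?b j s)"
          by (simp add: algebra_simps)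
        moreover have "coprime (2 ^ k) (?d i)"
          using odd by simp
        ultimately show "int (2 ^ k) dvd ?b i s - ?b j s"
          by (simp add: coprime_dvd_mult_right_iff)
        \<comment> \<open>Congruent column entries are equal only if both are reduced; for the entry
          1 of the first row this needs \<open>k \<ge> 1\<close>.\<close>
        have "\<forall>c\<in>column_factors k I ! s. c < 2 ^ k"
        proof -
          have "(1::nat) < 2 ^ k"
            using k by (intro one_less_power) auto
          then have "\<forall>A\<in>set (column_factors k I). \<forall>c\<in>A. c < 2 ^ k"
            by (auto simp: column_factors_def multiples_def)
          then show ?thesis
            using s nth_mem by blast
        qed
        then show "columns k I ! i ! s < 2 ^ k" "columns k I ! j ! s < 2 ^ k"
          using column_nth_in s lt by blast+
      qed
      then have "columns k I ! i = columns k I ! j"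
        using lt by (intro nth_equalityI) (simp_all add: length_column)
      then show False
        using distinct_columns lt ij by (simp add: nth_eq_iff_index_eq)
    qed
    \<comment> \<open>Transfers evenness from position \<open>i\<close> to \<open>j\<close>; the sum
      and the difference of two entries have the same parity.\<close>
    moreover have "even (?d i + ?d j)"
      using dij k by (meson dvd_power dvd_trans less_le_trans zero_less_one)
    ultimately show ?thesis
      by (auto simp: D)
  qed
  ultimately show ?thesis
    by linarith
qed

lemma even_sum_cong:
  fixes f g :: "'a \<Rightarrow> nat"
  assumes "\<And>i. i \<in> A \<Longrightarrow> even (f i) \<longleftrightarrow> even (g i)"
  shows "even (sum f A) \<longleftrightarrow> even (sum g A)"
  using assms by (induction A rule: infinite_finite_induct) auto

theorem theorem2:
  fixes k m r n :: nat and I :: "nat \<Rightarrow> nat" and H :: "nat \<Rightarrow> bit list set"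
  assumes "k \<ge> 1" and "m = 2 ^ (k - 1)" and "n = 2 ^ r"
    and "(\<Sum>t = 1..k. t * I t) = r"
    and "disjoint_family_on H {..<2 * m}"
    and "(\<Union>j<2 * m. H j) = words m"
    and "\<And>j. j < 2 * m \<Longrightarrow> extended_1_perfect m (H j)"
    and "replicate m 0 \<in> H 0"
    and "\<And>j w. j < 2 * m \<Longrightarrow> w \<in> H j \<Longrightarrow> even (hamming_weight w) \<longleftrightarrow> even j"
  shows "extended_1_perfect (n * m) (Phi_code H (kernel_code k I))"
proof -
  \<comment> \<open>There are as many codes \<open>H j\<close> as ring elements, so each codeword
    entry is a valid index.\<close>
  have m2: "2 * m = 2 ^ k"
    using assms(1,2) by (simp flip: power_Suc)
  have n: "length (columns k I) = n"
    using assms(3,4) by (simp add: length_columns)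
  have len: "length x = n" if "x \<in> kernel_code k I" for x
    using that n by (simp add: kernel_code_def)
  have nth_less: "x ! j < 2 * m" if "x \<in> kernel_code k I" "j < n" for x j
    using kernel_code_nth_less[OF that(1)] that(2) n m2 by simp
  have words: "length w = m" if "j < 2 * m" "w \<in> H j" for j w
    using assms(6) that by (auto simp: words_def)
  have blocks: "length us = n" "\<And>j. j < n \<Longrightarrow> us ! j \<in> H (x ! j) \<and> length (us ! j) = m"
    if "x \<in> kernel_code k I" "us \<in> listset (map H x)" for x us
    using that nth_less[OF that(1)] words len[OF that(1)] unfolding in_listset_iff by auto
  \<comment> \<open>All blocks have length \<open>m\<close>, so a concatenation determines its
    blocks.\<close>
  have concat_eq: "us = vs" if "x \<in> kernel_code k I" "y \<in> kernel_code k I"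
    "us \<in> listset (map H x)" "vs \<in> listset (map H y)" "concat us = concat vs" for x y us vs
  proof (rule concat_injective[OF that(5)])
    show "length us = length vs"
      using blocks(1)[OF that(1,3)] blocks(1)[OF that(2,4)] by simp
    show "\<forall>(u, v)\<in>set (zip us vs). length u = length v"
      using blocks[OF that(1,3)] blocks[OF that(2,4)] by (auto simp: set_zip)
  qed
  have H_disjoint: "x ! j = y ! j" if "x \<in> kernel_code k I" "y \<in> kernel_code k I" "j < n"
    "w \<in> H (x ! j)" "w \<in> H (y ! j)" for x y j w
    using assms(5) nth_less that unfolding disjoint_family_on_def by blast

  \<comment> \<open>Size of the image code\<close>
  have "2 * m dvd 2 ^ m"
    using assms(7)[of 0] m2 by (simp add: extended_1_perfect_def)
  then have "k \<le> m"
    unfolding m2 by (simp add: dvd_power_iff_le)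
  then have "(2::nat) ^ m = 2 ^ k * 2 ^ (m - k)"
    by (simp flip: power_add)
  then have cardH: "card (H j) = 2 ^ (m - k)" if "j < 2 * m" for j
    using assms(7)[OF that] unfolding extended_1_perfect_def binary_code_def m2 by simp
  \<comment> \<open>An infinite set has \<open>card\<close> equal to 0, which is not a power of
    2.\<close>
  have finH: "finite (H j)" if "j < 2 * m" for j
    using cardH[OF that] card.infinite[of "H j"] by fastforce
  have card_Phi: "card (Phi H x) = 2 ^ ((m - k) * n) \<and> finite (Phi H x)"
    if x: "x \<in> kernel_code k I" for x
  proof -
    have less: "\<forall>j\<in>set x. j < 2 * m"
      using nth_less[OF x] len[OF x] by (auto simp: in_set_conv_nth)
    then have "\<forall>A\<in>set (map H x). finite A"
      using finH by auto
    from finite_card_listset[OF this]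
    have "finite (listset (map H x))" "card (listset (map H x)) = prod_list (map (card \<circ> H) x)"
      by simp_all
    moreover have "map (card \<circ> H) x = replicate n (2 ^ (m - k))"
      using less len[OF x] cardH by (auto simp: list_eq_iff_nth_eq)
    moreover have "inj_on concat (listset (map H x))"
      by (intro inj_onI concat_eq[OF x x])
    ultimately show ?thesis
      by (simp add: Phi_def card_image prod_list_replicate power_mult)
  qed
  \<comment> \<open>A common word determines its blocks, and each block lies in only one
    \<open>H j\<close>, so the codeword can be read off.\<close>
  have disj: "x = y" if x: "x \<in> kernel_code k I" and y: "y \<in> kernel_code k I"
    and meet: "Phi H x \<inter> Phi H y \<noteq> {}" for x y
  proof -
    obtain us vs where us: "us \<in> listset (map H x)" "vs \<in> listset (map H y)" "concat us = concat vs"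
      using meet by (auto simp: Phi_def)
    then have "us = vs"
      using concat_eq[OF x y] by blast
    then have "x ! j = y ! j" if "j < n" for j
      using blocks(2)[OF x us(1) that] blocks(2)[OF y us(2) that] H_disjoint[OF x y that] by blast
    then show ?thesis
      using len[OF x] len[OF y] by (simp add: list_eq_iff_nth_eq)
  qed
  have fin: "finite (kernel_code k I)"
    using finite_ambient by (simp add: kernel_code_eq)
  have "card (Phi_code H (kernel_code k I)) = (\<Sum>x\<in>kernel_code k I. card (Phi H x))"
    unfolding Phi_code_def using fin card_Phi disj by (intro card_UN_disjoint) auto
  also have "\<dots> = card (kernel_code k I) * 2 ^ ((m - k) * n)"
    by (simp add: card_Phi)
  finally have "card (Phi_code H (kernel_code k I)) * (2 * (n * m))
      = card (kernel_code k I) * (2 ^ k * length (columns k I)) * 2 ^ ((m - k) * n)"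
    using m2 n by (simp add: algebra_simps)
  also have "\<dots> = 2 ^ (k * n + (m - k) * n)"
    unfolding card_kernel_code by (simp add: n power_add)
  also have "k * n + (m - k) * n = n * m"
    using \<open>k \<le> m\<close> by (simp flip: add_mult_distrib)
  finally have card: "card (Phi_code H (kernel_code k I)) * (2 * (n * m)) = 2 ^ (n * m)" .

  \<comment> \<open>Distance of the image code\<close>
  have "4 \<le> hamming_dist u v"
    if uv: "u \<in> Phi_code H (kernel_code k I)" "v \<in> Phi_code H (kernel_code k I)" "u \<noteq> v" for u v
  proof -
    obtain x us y vs where x: "x \<in> kernel_code k I" and us: "us \<in> listset (map H x)"
      and u: "u = concat us" and y: "y \<in> kernel_code k I" and vs: "vs \<in> listset (map H y)"
      and v: "v = concat vs"
      using uv(1,2) by (auto simp: Phi_code_def Phi_def)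
    note bu = blocks[OF x us] and bv = blocks[OF y vs]
    let ?d = "\<lambda>j. hamming_dist (us ! j) (vs ! j)"
    have dist: "hamming_dist u v = (\<Sum>j<n. ?d j)"
      using bu bv by (simp add: u v hamming_dist_concat)
    have pos: "?d j > 0" if "j < n" "us ! j \<noteq> vs ! j" for j
      using bu(2) bv(2) that by (intro hamming_dist_pos) simp_all
    \<comment> \<open>Words of \<open>H (x ! j)\<close> have the weight parity of
      \<open>x ! j\<close>, so the indices alone fix the parity of the block distance.\<close>
    have parity: "even (?d j) \<longleftrightarrow> even (x ! j + y ! j)" if j: "j < n" for j
      using bu(2)[OF j] bv(2)[OF j] assms(9)[OF nth_less[OF x j]] assms(9)[OF nth_less[OF y j]]
      by (simp add: even_hamming_dist_iff)
    show ?thesis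
    proof (cases "x = y")
      case True
      have "us \<noteq> vs"
        using uv(3) u v by blast
      then obtain j where j: "j < n" "us ! j \<noteq> vs ! j"
        using bu(1) bv(1) by (auto simp: list_eq_iff_nth_eq)
      then have "4 \<le> ?d j"
        using assms(7)[OF nth_less[OF x j(1)]] bu(2) bv(2) True
        by (auto simp: extended_1_perfect_def binary_code_def)
      also have "\<dots> \<le> (\<Sum>j<n. ?d j)"
        using j(1) by (intro member_le_sum) auto
      finally show ?thesis
        by (simp add: dist)
    next
      case False
      define D where "D = {j. j < n \<and> x ! j \<noteq> y ! j}"
      have D: "D \<subseteq> {..<n}" "finite D"
        by (auto simp: D_def)
      have le: "(\<Sum>j\<in>D. ?d j) \<le> hamming_dist u v"
        unfolding dist using D by (intro sum_mono2) auto
      have pos': "?d j > 0" if "j \<in> D" for j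
      proof (rule pos)
        show j: "j < n"
          using that by (simp add: D_def)
        show "us ! j \<noteq> vs ! j"
        proof
          assume "us ! j = vs ! j"
          then have "x ! j = y ! j"
            using H_disjoint[OF x y j, of "us ! j"] bu(2)[OF j] bv(2)[OF j] by simp
          then show False
            using that by (simp add: D_def)
        qed
      qed
      have "card D \<ge> 3 \<or> card D = 2 \<and> (\<forall>j\<in>D. even (x ! j + y ! j))"
        using kernel_code_difference[OF assms(1) x y False] by (simp add: D_def n)
      then show ?thesis
      proof
        assume "card D \<ge> 3"
        moreover have "card D \<le> (\<Sum>j\<in>D. ?d j)"
          using sum_mono[of D "\<lambda>_. 1::nat" ?d] pos' by (simp add: Suc_le_eq)
        moreover have "even (hamming_dist u v)"
        proof -
          \<comment> \<open>Block parities add up to the parity of the entry sums of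
            \<open>x\<close> and \<open>y\<close>, both even; a distance of at least 3 is therefore
            at least 4.\<close>
          have "even (hamming_dist u v) \<longleftrightarrow> even (\<Sum>j<n. x ! j + y ! j)"
            unfolding dist by (intro even_sum_cong parity) simp
          then show ?thesis
            using kernel_code_even_sum[OF assms(1) x] kernel_code_even_sum[OF assms(1) y]
            by (simp add: sum.distrib n)
        qed
        moreover have "hamming_dist u v \<noteq> 3"
          using calculation(3) by auto
        ultimately show ?thesis
          using le by linarith
      next
        assume *: "card D = 2 \<and> (\<forall>j\<in>D. even (x ! j + y ! j))"
        have "2 \<le> ?d j" if "j \<in> D" for j
        proof -
          have "even (?d j)"
            using * that parity by (simp add: D_def)
          then show ?thesis
            using pos'[OF that] by (auto elim!: evenE)
        qed
        then have "card D * 2 \<le> (\<Sum>j\<in>D. ?d j)"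
          using sum_mono[of D "\<lambda>_. 2::nat" ?d] by simp
        then show ?thesis
          using * le by simp
      qed
    qed
  qed
  moreover have "Phi_code H (kernel_code k I) \<subseteq> words (n * m)"
  proof
    fix w assume "w \<in> Phi_code H (kernel_code k I)"
    then obtain x us where x: "x \<in> kernel_code k I" "us \<in> listset (map H x)" "w = concat us"
      by (auto simp: Phi_code_def Phi_def)
    then have "length w = length us * m"
      using blocks[OF x(1,2)] unfolding x(3)
      by (intro length_concat_blocks) (auto simp: in_set_conv_nth)
    then show "w \<in> words (n * m)"
      using blocks(1)[OF x(1,2)] by (simp add: words_def)
  qed
  moreover have "2 * (n * m) dvd 2 ^ (n * m)"
    using card by (metis dvd_triv_right)
  moreover have "2 ^ (n * m) div (2 * (n * m)) = card (Phi_code H (kernel_code k I))"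
  proof -
    \<comment> \<open>Positivity allows cancelling the factor, so the quotient is exactly the
      counted size.\<close>
    have "2 * (n * m) > 0"
      using assms(2,3) by simp
    then show ?thesis
      unfolding card[symmetric] by (rule nonzero_mult_div_cancel_right[OF less_imp_neq[symmetric]])
  qed
  ultimately show ?thesis
    by (simp add: extended_1_perfect_def binary_code_def)
qed

end
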